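(* For every $k\ge2$, the integrality gap of (LP-MHV), the linear programming relaxation of the MHV problem with $k$ colors, has an upper bound of $\frac2k$: $$\inf_{I}\ \frac{\mathrm{OPT}(\mathrm{MHV})(I)}{\mathrm{OPT}(\text{LP-MHV})(I)}\ \le\ \frac2k,$$ where the infimum is over all MHV instances $I$ with $k$ colors and $\mathrm{OPT}(\text{LP-MHV})(I)>0$.
   Context: **MHV problem.** An instance consists of a finite undirected graph $G=(V,E)$, $V=\{v_1,\dots,v_n\}$, non-negative vertex weights $w_j=w(v_j)$, a color set $C=\{1,\dots,k\}$, and a partial vertex coloring $c$ with colors in $C$ in which every color is used on at least one vertex. $\mathrm{OPT}(\mathrm{MHV})(I)$ is the maximum, over all colorings of $V$ extending $c$, of the total weight of happy vertices (vertices having the same color as all their neighbors). **(LP-MHV).** $\mathrm{OPT}(\text{LP-MHV})(I)$ is the optimum value of: maximize $\sum_{j=1}^n w_jz_j$ subject to: $\sum_{i=1}^k y_j^i=1$ for all $v_j\in V$; $y_j^i=1$ whenever $c(v_j)=i$; $z_j^i=\min_{v_h\in N[v_j]}y_h^i$ for all $v_j\in V$, $i\in C$; $z_j=\sum_{i=1}^k z_j^i$ for all $v_j\in V$; and $z_j,z_j^i,y_j^i\ge0$. Here $N[v_j]$ is the closed neighborhood of $v_j$. *)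

theory Defs
  imports Complex_Main "HOL-Library.FuncSet" "HOL-Library.Extended_Real"
begin

text \<open>
  The vertices of an instance are the numbers from 1 to \<open>num_verts\<close>, the colors are the
  numbers from 1 to \<open>k\<close>. A partial coloring maps the uncolored vertices to \<open>None\<close>.
\<close>

record mhv_instance =
  num_verts :: nat
  edges :: "nat set set"
  weight :: "nat \<Rightarrow> real"
  precolor :: "nat \<Rightarrow> nat option"

definition verts :: "mhv_instance \<Rightarrow> nat set" where
  "verts I = {1..num_verts I}"

definition colors :: "nat \<Rightarrow> nat set" where
  "colors k = {1..k}"

definition is_mhv_instance :: "nat \<Rightarrow> mhv_instance \<Rightarrow> bool" where
  "is_mhv_instance k I \<longleftrightarrow>
     (\<forall>e\<in>edges I. e \<subseteq> verts I \<and> card e = 2) \<and>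
     (\<forall>j\<in>verts I. weight I j \<ge> 0) \<and>
     dom (precolor I) \<subseteq> verts I \<and>
     ran (precolor I) = colors k"

definition closed_nbhd :: "mhv_instance \<Rightarrow> nat \<Rightarrow> nat set" where
  "closed_nbhd I j = insert j {h \<in> verts I. {j, h} \<in> edges I}"

definition extending_colorings :: "nat \<Rightarrow> mhv_instance \<Rightarrow> (nat \<Rightarrow> nat) set" where
  "extending_colorings k I =
     {f \<in> verts I \<rightarrow>\<^sub>E colors k. \<forall>j i. precolor I j = Some i \<longrightarrow> f j = i}"

definition happy_verts :: "mhv_instance \<Rightarrow> (nat \<Rightarrow> nat) \<Rightarrow> nat set" where
  "happy_verts I f = {j \<in> verts I. \<forall>h\<in>verts I. {j, h} \<in> edges I \<longrightarrow> f h = f j}"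

definition opt_mhv :: "nat \<Rightarrow> mhv_instance \<Rightarrow> real" where
  "opt_mhv k I = (MAX f\<in>extending_colorings k I. \<Sum>j\<in>happy_verts I f. weight I j)"

text \<open>
  In the constraints below, \<open>y j i\<close>, \<open>zc j i\<close> and \<open>z j\<close> stand for \<open>y\<close> and \<open>z\<close> with
  lower index \<open>j\<close> and upper index \<open>i\<close>, and for \<open>z\<close> with lower index \<open>j\<close>.
\<close>

definition lp_mhv_feasible ::
  "nat \<Rightarrow> mhv_instance \<Rightarrow> (nat \<Rightarrow> nat \<Rightarrow> real) \<Rightarrow> (nat \<Rightarrow> nat \<Rightarrow> real) \<Rightarrow> (nat \<Rightarrow> real) \<Rightarrow> bool" where
  "lp_mhv_feasible k I y zc z \<longleftrightarrow>
     (\<forall>j\<in>verts I. (\<Sum>i\<in>colors k. y j i) = 1) \<and>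
     (\<forall>j\<in>verts I. \<forall>i\<in>colors k. precolor I j = Some i \<longrightarrow> y j i = 1) \<and>
     (\<forall>j\<in>verts I. \<forall>i\<in>colors k. zc j i = (MIN h\<in>closed_nbhd I j. y h i)) \<and>
     (\<forall>j\<in>verts I. z j = (\<Sum>i\<in>colors k. zc j i)) \<and>
     (\<forall>j\<in>verts I. z j \<ge> 0) \<and>
     (\<forall>j\<in>verts I. \<forall>i\<in>colors k. zc j i \<ge> 0 \<and> y j i \<ge> 0)"

definition lp_mhv_values :: "nat \<Rightarrow> mhv_instance \<Rightarrow> real set" where
  "lp_mhv_values k I =
     {\<Sum>j\<in>verts I. weight I j * z j | y zc z. lp_mhv_feasible k I y zc z}"

definition opt_lp_mhv :: "nat \<Rightarrow> mhv_instance \<Rightarrow> real" where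
  "opt_lp_mhv k I = Sup (lp_mhv_values k I)"

text \<open>
  The maximum and the supremum above are taken over suitable sets, so neither of the two
  optima is an unspecified value.
\<close>

lemma finite_verts [simp]: "finite (verts I)"
  by (simp add: verts_def)

lemma finite_colors [simp]: "finite (colors k)"
  by (simp add: colors_def)

lemma finite_closed_nbhd [simp]: "finite (closed_nbhd I j)"
  by (simp add: closed_nbhd_def)

lemma finite_extending_colorings: "finite (extending_colorings k I)"
  unfolding extending_colorings_def
  by (rule finite_subset[OF _ finite_PiE[of "verts I" "\<lambda>_. colors k"]]) auto

lemma extending_colorings_nonempty:
  assumes "is_mhv_instance k I" "k \<ge> 1"
  shows "extending_colorings k I \<noteq> {}"
proof -
  define f where "f = (\<lambda>j\<in>verts I. case precolor I j of None \<Rightarrow> 1 | Some i \<Rightarrow> i)"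
  have "f j \<in> colors k" if "j \<in> verts I" for j
    using assms that by (auto simp: f_def is_mhv_instance_def colors_def ran_def split: option.splits)
  moreover have "f j = i" if "precolor I j = Some i" for j i
    using assms that by (auto simp: f_def is_mhv_instance_def)
  moreover have "f \<in> extensional (verts I)" by (simp add: f_def)
  ultimately have "f \<in> extending_colorings k I"
    by (auto simp: extending_colorings_def PiE_def)
  then show ?thesis by blast
qed

lemma lp_mhv_values_nonempty:
  assumes "is_mhv_instance k I" "k \<ge> 1"
  shows "lp_mhv_values k I \<noteq> {}"
proof -
  obtain f where f: "f \<in> extending_colorings k I"
    using extending_colorings_nonempty[OF assms] by blast
  define y :: "nat \<Rightarrow> nat \<Rightarrow> real" where "y = (\<lambda>j i. if f j = i then 1 else 0)"
  define zc where "zc = (\<lambda>j i. MIN h\<in>closed_nbhd I j. y h i)"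
  have zc: "zc j i \<ge> 0" for j i
    unfolding zc_def by (subst Min_ge_iff) (auto simp: closed_nbhd_def y_def)
  have "lp_mhv_feasible k I y zc (\<lambda>j. \<Sum>i\<in>colors k. zc j i)"
    using f zc unfolding lp_mhv_feasible_def extending_colorings_def
    by (auto simp: y_def zc_def intro!: sum_nonneg)
  then show ?thesis by (auto simp: lp_mhv_values_def)
qed

lemma lp_mhv_values_bdd_above:
  assumes "is_mhv_instance k I"
  shows "bdd_above (lp_mhv_values k I)"
proof (rule bdd_aboveI)
  fix x assume "x \<in> lp_mhv_values k I"
  then obtain y zc z where x: "x = (\<Sum>j\<in>verts I. weight I j * z j)"
    and feas: "lp_mhv_feasible k I y zc z" by (auto simp: lp_mhv_values_def)
  have "z j \<le> 1" if j: "j \<in> verts I" for j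
  proof -
    have "zc j i \<le> y j i" if "i \<in> colors k" for i
      using feas j that by (auto simp: lp_mhv_feasible_def closed_nbhd_def)
    then have "(\<Sum>i\<in>colors k. zc j i) \<le> (\<Sum>i\<in>colors k. y j i)" by (rule sum_mono)
    then show ?thesis using feas j by (simp add: lp_mhv_feasible_def)
  qed
  then show "x \<le> (\<Sum>j\<in>verts I. weight I j)"
    unfolding x using assms by (intro sum_mono) (auto simp: is_mhv_instance_def mult_left_le)
qed

end

theory Submission
  imports Defs
begin

text \<open>
  The gap instance has one vertex of weight one for each color, precolored with it, and an
  uncolored vertex of weight zero for each pair of colors, adjacent to the two vertices of these
  colors. Two vertices of positive weight cannot both be happy, as they disagree on their common
  neighbor, so the integral optimum is at most 1. Splitting each pair vertex evenly between its
  two colors gives each of the \<open>k\<close> vertices of positive weight the value 1/2, so the optimum of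
  the relaxation is at least \<open>k/2\<close>.
\<close>

text \<open>
  Vertex \<open>i \<le> k\<close> is the one of color \<open>i\<close>; vertex \<open>k + (a - 1) * k + b\<close> is the one of the ordered
  pair \<open>(a, b)\<close>, where \<open>a = b\<close> is allowed.
\<close>

definition pair_fst :: "nat \<Rightarrow> nat \<Rightarrow> nat" where
  "pair_fst k u = (u - k - 1) div k + 1"

definition pair_snd :: "nat \<Rightarrow> nat \<Rightarrow> nat" where
  "pair_snd k u = (u - k - 1) mod k + 1"

text \<open>A pair vertex with two equal colors is a leaf: both alternatives then give the same
  edge. Keeping these and both orders of a pair makes decoding by \<open>div\<close> and
  \<open>mod\<close> uniform.\<close>

definition pair_edges :: "nat \<Rightarrow> nat set set" where
  "pair_edges k = {{p, u} | p u. p \<in> {1..k} \<and> u \<in> {k<..k + k * k} \<and>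
     (p = pair_fst k u \<or> p = pair_snd k u)}"

definition gap_instance :: "nat \<Rightarrow> mhv_instance" where
  "gap_instance k =
     \<lparr>num_verts = k + k * k, edges = pair_edges k,
      weight = (\<lambda>j. if j \<le> k then 1 else 0),
      precolor = (\<lambda>j. if j \<in> {1..k} then Some j else None)\<rparr>"

lemma pair_fst_in_colors:
  assumes "u \<in> {k<..k + k * k}"
  shows "pair_fst k u \<in> {1..k}"
proof -
  have "u - k - 1 < k * k" using assms by auto
  then have "(u - k - 1) div k < k" by (simp add: less_mult_imp_div_less)
  then show ?thesis by (simp add: pair_fst_def)
qed

lemma pair_snd_in_colors:
  assumes "u \<in> {k<..k + k * k}"
  shows "pair_snd k u \<in> {1..k}"
proof -
  have "k > 0" using assms by (cases k) auto
  then have "(u - k - 1) mod k < k" by simp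
  then show ?thesis by (simp add: pair_snd_def)
qed

text \<open>Supplies the common neighbor of two color vertices. With zero-based \<open>a'\<close>
  and \<open>b'\<close>, decoding is division of \<open>a' * k + b'\<close> by \<open>k\<close>,
  with remainder \<open>b' < k\<close>.\<close>

lemma pair_vertex_exists:
  assumes "a \<in> {1..k}" "b \<in> {1..k}"
  obtains u where "u \<in> {k<..k + k * k}" "pair_fst k u = a" "pair_snd k u = b"
proof -
  obtain a' where a': "a = Suc a'" "a' < k" using assms(1) by (cases a) auto
  obtain b' where b': "b = Suc b'" "b' < k" using assms(2) by (cases b) auto
  have "Suc a' * k \<le> k * k" using a' by (intro mult_le_mono1) simp
  then have "Suc (k + a' * k + b') \<in> {k<..k + k * k}" using b' by auto
  moreover have "Suc (k + a' * k + b') - k - 1 = a' * k + b'" by simp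
  then have "pair_fst k (Suc (k + a' * k + b')) = a" "pair_snd k (Suc (k + a' * k + b')) = b"
    unfolding pair_fst_def pair_snd_def using a' b' by simp_all
  ultimately show thesis by (rule that)
qed

text \<open>An edge is an unordered set; the bound on \<open>p\<close> decides which endpoint is the
  color vertex, since pair vertices exceed \<open>k\<close>.\<close>

lemma pair_edge_iff:
  assumes "p \<le> k"
  shows "{p, u} \<in> pair_edges k \<longleftrightarrow> p \<in> {1..k} \<and> u \<in> {k<..k + k * k} \<and>
    (p = pair_fst k u \<or> p = pair_snd k u)"
  using assms by (auto simp: pair_edges_def doubleton_eq_iff)

lemma gap_instance_is_mhv_instance: "is_mhv_instance k (gap_instance k)"
proof -
  have "e \<subseteq> verts (gap_instance k) \<and> card e = 2" if "e \<in> pair_edges k" for e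
    using that by (auto simp: pair_edges_def gap_instance_def verts_def card_insert_if)
  then show ?thesis
    by (auto simp: is_mhv_instance_def gap_instance_def verts_def colors_def ran_def
        split: if_splits)
qed

lemma gap_instance_opt_mhv_le:
  assumes "k \<ge> 1"
  shows "opt_mhv k (gap_instance k) \<le> 1"
proof -
  let ?I = "gap_instance k"
  have "(\<Sum>j\<in>happy_verts ?I f. weight ?I j) \<le> 1" if f: "f \<in> extending_colorings k ?I" for f
  proof -
    let ?H = "happy_verts ?I f"
    have fix_color: "f i = i" if "i \<in> {1..k}" for i
      using f that by (auto simp: extending_colorings_def gap_instance_def)
    \<comment> \<open>Intersecting with \<open>{..k}\<close> leaves exactly the happy vertices of
      weight one.\<close>
    have "a = b" if "a \<in> ?H \<inter> {..k}" "b \<in> ?H \<inter> {..k}" for a b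
    proof -
      have ab: "a \<in> {1..k}" "b \<in> {1..k}"
        using that by (auto simp: happy_verts_def verts_def)
      obtain u where u: "u \<in> {k<..k + k * k}" "pair_fst k u = a" "pair_snd k u = b"
        using pair_vertex_exists[OF ab] .
      have "u \<in> verts ?I" using u by (auto simp: verts_def gap_instance_def)
      moreover have "{a, u} \<in> edges ?I" "{b, u} \<in> edges ?I"
        using ab u by (auto simp: gap_instance_def pair_edge_iff)
      ultimately have "f u = f a" "f u = f b"
        using that by (auto simp: happy_verts_def)
      then show ?thesis using fix_color ab by simp
    qed
    then have "card (?H \<inter> {..k}) \<le> 1"
      by (auto simp: card_le_Suc0_iff_eq)
    moreover have "finite ?H" by (simp add: happy_verts_def)
    then have "(\<Sum>j\<in>?H. weight ?I j) = (\<Sum>j\<in>?H \<inter> {..k}. 1)"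
      unfolding gap_instance_def by (subst sum.inter_restrict) auto
    ultimately show ?thesis by simp
  qed
  then show ?thesis
    unfolding opt_mhv_def
    using extending_colorings_nonempty[OF gap_instance_is_mhv_instance assms]
    by (subst Max_le_iff) (auto simp: finite_extending_colorings)
qed

lemma gap_instance_opt_lp_ge: "opt_lp_mhv k (gap_instance k) \<ge> real k / 2"
proof -
  let ?I = "gap_instance k"
  \<comment> \<open>Only \<open>y\<close> is a choice: the constraints determine \<open>zc\<close>
    and \<open>z\<close> from it. If the two colors of a pair vertex coincide, the halves add up to
    1 on that color, so the sum over colors is still 1.\<close>
  define y :: "nat \<Rightarrow> nat \<Rightarrow> real" where
    "y = (\<lambda>j i. if j \<le> k then of_bool (i = j)
                else (of_bool (i = pair_fst k j) + of_bool (i = pair_snd k j)) / 2)"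
  define zc where "zc = (\<lambda>j i. MIN h\<in>closed_nbhd ?I j. y h i)"
  define z where "z = (\<lambda>j. \<Sum>i\<in>colors k. zc j i)"
  have nbhd_ne: "closed_nbhd ?I j \<noteq> {}" for j by (simp add: closed_nbhd_def)
  have zc_nonneg: "zc j i \<ge> 0" for j i
    unfolding zc_def using nbhd_ne by (subst Min_ge_iff) (auto simp: y_def)
  have sum_y: "(\<Sum>i\<in>colors k. y j i) = 1" if "j \<in> verts ?I" for j
  proof (cases "j \<le> k")
    case True
    then show ?thesis using that by (auto simp: y_def colors_def verts_def of_bool_def)
  next
    case False
    then have "j \<in> {k<..k + k * k}" using that by (auto simp: verts_def gap_instance_def)
    from pair_fst_in_colors[OF this] pair_snd_in_colors[OF this] False show ?thesis
      by (simp add: y_def colors_def of_bool_def sum.distrib flip: sum_divide_distrib)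
  qed
  have "lp_mhv_feasible k ?I y zc z"
    unfolding lp_mhv_feasible_def
  proof (intro conjI ballI impI)
    show "y j i = 1" if "precolor ?I j = Some i" for j i
      using that by (auto simp: gap_instance_def y_def split: if_splits)
    show "y j i \<ge> 0" for j i by (simp add: y_def)
    show "zc j i = (MIN h\<in>closed_nbhd ?I j. y h i)" for j i by (simp add: zc_def)
    show "z j = (\<Sum>i\<in>colors k. zc j i)" for j by (simp add: z_def)
    show "z j \<ge> 0" for j unfolding z_def by (intro sum_nonneg zc_nonneg)
  qed (use sum_y zc_nonneg in blast)+
  then have "(\<Sum>j\<in>verts ?I. weight ?I j * z j) \<in> lp_mhv_values k ?I"
    by (auto simp: lp_mhv_values_def)
  then have value_le: "(\<Sum>j\<in>verts ?I. weight ?I j * z j) \<le> opt_lp_mhv k ?I"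
    unfolding opt_lp_mhv_def
    by (intro cSup_upper lp_mhv_values_bdd_above gap_instance_is_mhv_instance)
  have half: "z j \<ge> 1 / 2" if j: "j \<in> {1..k}" for j
  proof -
    \<comment> \<open>Every neighbor of color vertex \<open>j\<close> is a pair vertex having
      \<open>j\<close> among its colors, so its share of \<open>j\<close> is 1/2 or 1.\<close>
    have "y h j \<ge> 1 / 2" if "h \<in> closed_nbhd ?I j" for h
    proof (cases "h = j")
      case True
      then show ?thesis using j by (simp add: y_def)
    next
      case False
      then have "{j, h} \<in> pair_edges k"
        using that by (simp add: closed_nbhd_def gap_instance_def)
      then have "\<not> h \<le> k" "j = pair_fst k h \<or> j = pair_snd k h"
        using j by (auto simp: pair_edge_iff)
      then show ?thesis by (auto simp: y_def)
    qed
    then have "zc j j \<ge> 1 / 2"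
      unfolding zc_def using nbhd_ne by (subst Min_ge_iff) auto
    also have "zc j j \<le> z j"
      \<comment> \<open>Keeping only the summand of the vertex's own color suffices, as the others
        are nonnegative.\<close>
      unfolding z_def using j zc_nonneg by (intro member_le_sum) (auto simp: colors_def)
    finally show ?thesis .
  qed
  have "real k / 2 = (\<Sum>j\<in>{1..k}. 1 / 2)" by simp
  also have "\<dots> \<le> (\<Sum>j\<in>{1..k}. weight ?I j * z j)"
    using half by (intro sum_mono) (auto simp: gap_instance_def)
  \<comment> \<open>The added pair vertices have weight zero.\<close>
  also have "\<dots> = (\<Sum>j\<in>verts ?I. weight ?I j * z j)"
    by (rule sum.mono_neutral_left) (auto simp: verts_def gap_instance_def)
  also note value_le
  finally show ?thesis .
qed

theorem theorem6:
  fixes k :: nat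
  assumes "k \<ge> 2"
  shows "(INF I\<in>{I :: mhv_instance. is_mhv_instance k I \<and> opt_lp_mhv k I > 0}.
            ereal (opt_mhv k I / opt_lp_mhv k I)) \<le> ereal (2 / real k)"
proof (rule INF_lower2)
  have lp: "opt_lp_mhv k (gap_instance k) \<ge> real k / 2" by (rule gap_instance_opt_lp_ge)
  have k: "real k / 2 > 0" using assms by simp
  show "gap_instance k \<in> {I. is_mhv_instance k I \<and> opt_lp_mhv k I > 0}"
    using gap_instance_is_mhv_instance lp k by auto
  have "opt_mhv k (gap_instance k) / opt_lp_mhv k (gap_instance k)
      \<le> 1 / opt_lp_mhv k (gap_instance k)"
    using gap_instance_opt_mhv_le assms lp k by (intro divide_right_mono) auto
  also have "\<dots> \<le> 1 / (real k / 2)"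
    using lp k by (intro divide_left_mono) auto
  finally show "ereal (opt_mhv k (gap_instance k) / opt_lp_mhv k (gap_instance k))
      \<le> ereal (2 / real k)"
    by simp
qed

end
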